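(* For each $m\ge 1$, the simplicial complex $\mathrm{Ind}(G_m)$ is obtained from the boundary complex of the $m$-dimensional crosspolytope by a sequence of $m-1$ edge subdivisions.
   Context: $\mathrm{Ind}(G)$ is the independence complex of $G$ (faces are independent sets). The $m$-dimensional crosspolytope is the convex hull of $m$ mutually orthogonal segments in $\mathbb{R}^m$ meeting at their common midpoint; its boundary complex is the independence complex of a perfect matching on $2m$ vertices. Edge subdivision of a simplicial complex $\Delta$ at an edge $\{x,y\}$ is the complex on $V(\Delta)\sqcup\{a\}$ whose faces are all $\sigma\in\Delta$ not containing $\{x,y\}$, together with $(\sigma\setminus\{x\})\cup\{a\}$ and $(\sigma\setminus\{y\})\cup\{a\}$ for every $\sigma\in\Delta$ containing $\{x,y\}$. The graphs $G_m$: $G_1$ has vertices $a_1,b_1$ and edge $a_1b_1$; for $m\ge1$, $G_{m+1}$ is obtained from $G_m$ by adding vertices $a_{m+1},b_{m+1},c_{m+1}$ and edges $a_ma_{m+1}$, $b_mc_{m+1}$, $a_{m+1}b_{m+1}$, $b_{m+1}c_{m+1}$, and, when $m\ge2$, also $c_ma_{m+1}$. Complexes are considered up to isomorphism.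
   Formalization: The listed faces of an edge subdivision are not closed under subsets (for instance {a} is missing), so the edge subdivision is taken to be the complex they generate, i.e. all subsets of the listed faces, which is the usual stellar subdivision of an edge. *)

theory Defs
  imports "HOL-Analysis.Analysis"
begin

type_synonym 'v graph = "'v set \<times> 'v set set"

definition ind_complex :: "'v graph \<Rightarrow> 'v set set" where
  "ind_complex G = {\<sigma>. finite \<sigma> \<and> \<sigma> \<subseteq> fst G \<and> (\<forall>e \<in> snd G. \<not> e \<subseteq> \<sigma>)}"

datatype vertex = Va nat | Vb nat | Vc nat

text \<open>The case \<open>0\<close> is a dummy value; the family starts at \<open>1\<close>.\<close>

fun G_graph :: "nat \<Rightarrow> vertex graph" where
  "G_graph 0 = ({}, {})"
| "G_graph (Suc 0) = ({Va 1, Vb 1}, {{Va 1, Vb 1}})"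
| "G_graph (Suc (Suc k)) =
    (let m = Suc k; (V, E) = G_graph m in
      (V \<union> {Va (m+1), Vb (m+1), Vc (m+1)},
       E \<union> {{Va m, Va (m+1)}, {Vb m, Vc (m+1)}, {Va (m+1), Vb (m+1)}, {Vb (m+1), Vc (m+1)}}
         \<union> (if m \<ge> 2 then {{Vc m, Va (m+1)}} else {})))"

definition simplicial_complex :: "'v set set \<Rightarrow> bool" where
  "simplicial_complex \<Delta> \<longleftrightarrow>
     (\<forall>\<sigma>\<in>\<Delta>. finite \<sigma>) \<and> (\<forall>\<sigma>\<in>\<Delta>. \<forall>\<tau>. \<tau> \<subseteq> \<sigma> \<longrightarrow> \<tau> \<in> \<Delta>)"

definition simplicial_iso :: "'v set set \<Rightarrow> 'w set set \<Rightarrow> bool" where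
  "simplicial_iso \<Delta> \<Gamma> \<longleftrightarrow>
     (\<exists>f. bij_betw f (\<Union>\<Delta>) (\<Union>\<Gamma>) \<and> (\<lambda>\<sigma>. f ` \<sigma>) ` \<Delta> = \<Gamma>)"

text \<open>The sets \<open>(\<sigma> - {x}) \<union> {a}\<close> and \<open>(\<sigma> - {y}) \<union> {a}\<close> with \<open>{x, y} \<subseteq> \<sigma>\<close> each
  contain \<open>x\<close> or \<open>y\<close>, so they do not include faces such as \<open>{a}\<close>. The subdivision is the
  complex they generate together with the faces not containing \<open>{x, y}\<close>, hence the closure
  under subsets.\<close>

definition subdivide_edge :: "'v \<Rightarrow> 'v \<Rightarrow> 'v \<Rightarrow> 'v set set \<Rightarrow> 'v set set" where
  "subdivide_edge x y a \<Delta> =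
     {\<tau>. \<exists>\<rho> \<in> {\<sigma> \<in> \<Delta>. \<not> {x, y} \<subseteq> \<sigma>}
            \<union> {(\<sigma> - {x}) \<union> {a} | \<sigma>. \<sigma> \<in> \<Delta> \<and> {x, y} \<subseteq> \<sigma>}
            \<union> {(\<sigma> - {y}) \<union> {a} | \<sigma>. \<sigma> \<in> \<Delta> \<and> {x, y} \<subseteq> \<sigma>}. \<tau> \<subseteq> \<rho>}"

definition edge_subdivision :: "'v set set \<Rightarrow> 'v set set \<Rightarrow> bool" where
  "edge_subdivision \<Delta> \<Delta>' \<longleftrightarrow>
     simplicial_complex \<Delta> \<and>
     (\<exists>x y a. x \<noteq> y \<and> {x, y} \<in> \<Delta> \<and> a \<notin> \<Union>\<Delta> \<and> \<Delta>' = subdivide_edge x y a \<Delta>)"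

text \<open>The segments are indexed by the coordinate type, so there are as many of them as the
  dimension of the space; \<open>c\<close> is their common midpoint.\<close>

definition crosspolytope :: "(real ^ 'n) set \<Rightarrow> bool" where
  "crosspolytope P \<longleftrightarrow>
     (\<exists>c (u :: 'n \<Rightarrow> real ^ 'n).
        (\<forall>i. u i \<noteq> 0) \<and> (\<forall>i j. i \<noteq> j \<longrightarrow> orthogonal (u i) (u j)) \<and>
        P = convex hull (\<Union>i. closed_segment (c - u i) (c + u i)))"

text \<open>Abstract version of the boundary complex: each proper face of \<open>P\<close> (including the empty
  face) is recorded by its set of vertices.\<close>

definition boundary_complex :: "'a::euclidean_space set \<Rightarrow> 'a set set" where
  "boundary_complex P = {{v. v extreme_point_of F} | F. F face_of P \<and> F \<noteq> P}"

end

theory Submission imports Defs begin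

text \<open>
  Subdividing \<open>Ind(G)\<close> at an edge \<open>{x, y}\<close> yields \<open>Ind(G')\<close>, where \<open>G'\<close> arises from \<open>G\<close> by
  adding the edge \<open>xy\<close> and a new vertex joined to all neighbours of \<open>x\<close> and \<open>y\<close>. The neighbours of
  \<open>b\<^sub>k\<close> in \<open>G\<^sub>k\<close> are \<open>a\<^sub>k\<close> and (for \<open>k \<ge> 2\<close>) \<open>c\<^sub>k\<close>; hence the subdivision of \<open>Ind\<close> of the disjoint
  union of \<open>G\<^sub>k\<close> and the edge \<open>b\<^sub>k\<^sub>+\<^sub>1c\<^sub>k\<^sub>+\<^sub>1\<close> at \<open>{b\<^sub>k, c\<^sub>k\<^sub>+\<^sub>1}\<close>, with new vertex \<open>a\<^sub>k\<^sub>+\<^sub>1\<close>, is \<open>Ind(G\<^sub>k\<^sub>+\<^sub>1)\<close>.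
  Starting from the perfect matching \<open>a\<^sub>1b\<^sub>1, b\<^sub>2c\<^sub>2, \<dots>, b\<^sub>mc\<^sub>m\<close>, whose independence complex is the
  boundary of the crosspolytope, \<open>m - 1\<close> such steps lead to \<open>G\<^sub>m\<close>.
\<close>

section \<open>Isomorphisms and subdivisions\<close>

text \<open>Surjectivity onto the vertices of \<open>\<Gamma>\<close> is automatic, since they are
  covered by the images of faces.\<close>

lemma simplicial_iso_iff:
  "simplicial_iso \<Delta> \<Gamma> \<longleftrightarrow> (\<exists>f. inj_on f (\<Union>\<Delta>) \<and> (`) f ` \<Delta> = \<Gamma>)"
proof -
  have "bij_betw f (\<Union>\<Delta>) (\<Union>\<Gamma>) \<longleftrightarrow> inj_on f (\<Union>\<Delta>)" if "(`) f ` \<Delta> = \<Gamma>" for f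
    using that by (auto simp: bij_betw_def)
  then show ?thesis
    unfolding simplicial_iso_def by blast
qed

text \<open>The map \<open>h \<circ> inv g\<close> passes through the common model \<open>K\<close>.
  Thus the boundary complex and the matching on \<open>vertex\<close> need only be compared with one
  model each.\<close>

lemma simplicial_iso_images:
  assumes "inj g" "inj h"
  shows "simplicial_iso ((`) g ` K) ((`) h ` K)"
proof -
  have "(h \<circ> inv g) ` (g ` \<sigma>) = h ` \<sigma>" for \<sigma>
    using assms(1) by (simp add: image_comp o_def)
  then have "(`) (h \<circ> inv g) ` ((`) g ` K) = (`) h ` K"
    by (simp add: image_image)
  moreover have "inj_on (h \<circ> inv g) (\<Union>((`) g ` K))"
    using assms by (auto simp: inj_on_def)
  ultimately show ?thesis
    unfolding simplicial_iso_iff by blast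
qed

text \<open>\<open>edge_subdivision\<close> demands a simplicial complex as its source, so this
  property has to be pulled back along isomorphisms.\<close>

lemma simplicial_complex_if_iso:
  assumes iso: "simplicial_iso \<Delta> \<Gamma>" and \<Gamma>: "simplicial_complex \<Gamma>"
  shows "simplicial_complex \<Delta>"
proof -
  obtain f where inj: "inj_on f (\<Union>\<Delta>)" and img: "(`) f ` \<Delta> = \<Gamma>"
    using iso unfolding simplicial_iso_iff by blast
  show ?thesis
    unfolding simplicial_complex_def
  proof (intro conjI ballI allI impI)
    fix \<sigma> assume \<sigma>: "\<sigma> \<in> \<Delta>"
    then have f\<sigma>: "f ` \<sigma> \<in> \<Gamma>" using img by blast
    have sub: "\<sigma> \<subseteq> \<Union>\<Delta>" using \<sigma> by blast
    show "finite \<sigma>"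
      using f\<sigma> \<Gamma> inj_on_subset[OF inj sub] finite_imageD
      unfolding simplicial_complex_def by blast
    fix \<tau> assume \<tau>: "\<tau> \<subseteq> \<sigma>"
    then have "f ` \<tau> \<in> \<Gamma>"
      using f\<sigma> \<Gamma> image_mono unfolding simplicial_complex_def by metis
    then obtain \<rho> where \<rho>: "\<rho> \<in> \<Delta>" "f ` \<tau> = f ` \<rho>" using img by blast
    have "\<tau> = \<rho>"
      using inj_on_image_eq_iff[OF inj, of \<tau> \<rho>] \<rho> \<tau> sub by blast
    then show "\<tau> \<in> \<Delta>" using \<rho> by simp
  qed
qed

text \<open>The faces before closure under subsets, written with images of functions so that
  relabelling reduces to composing images.\<close>

definition subdivision_generators :: "'v \<Rightarrow> 'v \<Rightarrow> 'v \<Rightarrow> 'v set set \<Rightarrow> 'v set set" where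
  "subdivision_generators x y a \<Delta> =
     {\<sigma> \<in> \<Delta>. \<not> {x, y} \<subseteq> \<sigma>}
       \<union> (\<lambda>\<sigma>. (\<sigma> - {x}) \<union> {a}) ` {\<sigma> \<in> \<Delta>. {x, y} \<subseteq> \<sigma>}
       \<union> (\<lambda>\<sigma>. (\<sigma> - {y}) \<union> {a}) ` {\<sigma> \<in> \<Delta>. {x, y} \<subseteq> \<sigma>}"

lemma subdivide_edge_eq:
  "subdivide_edge x y a \<Delta> = {\<tau>. \<exists>\<rho> \<in> subdivision_generators x y a \<Delta>. \<tau> \<subseteq> \<rho>}"
  unfolding subdivide_edge_def subdivision_generators_def by (rule Collect_cong) blast

lemma Union_subdivide_edge_subset: "\<Union>(subdivide_edge x y a \<Delta>) \<subseteq> insert a (\<Union>\<Delta>)"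
  unfolding subdivide_edge_eq subdivision_generators_def by fastforce

text \<open>Injectivity on the old vertices together with \<open>a\<close> preserves both
  containment of \<open>{x, y}\<close> and removal of an endpoint, so generators are mapped onto
  generators.\<close>

lemma image_subdivide_edge:
  assumes inj: "inj_on g (insert a (\<Union>\<Delta>))" and x: "x \<in> \<Union>\<Delta>" and y: "y \<in> \<Union>\<Delta>"
  shows "(`) g ` subdivide_edge x y a \<Delta> = subdivide_edge (g x) (g y) (g a) ((`) g ` \<Delta>)"
proof -
  have edge: "{g x, g y} \<subseteq> g ` \<sigma> \<longleftrightarrow> {x, y} \<subseteq> \<sigma>" if "\<sigma> \<in> \<Delta>" for \<sigma>
  proof -
    have "\<sigma> \<subseteq> insert a (\<Union>\<Delta>)" using that by blast
    then show ?thesis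
      using inj_on_image_mem_iff[OF inj, of _ \<sigma>] x y by simp
  qed
  have del: "g ` ((\<sigma> - {z}) \<union> {a}) = (g ` \<sigma> - {g z}) \<union> {g a}" if "\<sigma> \<in> \<Delta>" "z \<in> \<Union>\<Delta>" for \<sigma> z
  proof -
    have "g ` (\<sigma> - {z}) = g ` \<sigma> - g ` {z}"
      by (rule inj_on_image_set_diff[OF inj]) (use that in auto)
    then show ?thesis by auto
  qed
  have filter: "{\<sigma> \<in> (`) g ` \<Delta>. {g x, g y} \<subseteq> \<sigma>} = (`) g ` {\<sigma> \<in> \<Delta>. {x, y} \<subseteq> \<sigma>}"
    "{\<sigma> \<in> (`) g ` \<Delta>. \<not> {g x, g y} \<subseteq> \<sigma>} = (`) g ` {\<sigma> \<in> \<Delta>. \<not> {x, y} \<subseteq> \<sigma>}"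
    using edge by blast+
  have "(\<lambda>\<sigma>. (\<sigma> - {g z}) \<union> {g a}) ` {\<sigma> \<in> (`) g ` \<Delta>. {g x, g y} \<subseteq> \<sigma>}
      = (`) g ` (\<lambda>\<sigma>. (\<sigma> - {z}) \<union> {a}) ` {\<sigma> \<in> \<Delta>. {x, y} \<subseteq> \<sigma>}" if "z \<in> \<Union>\<Delta>" for z
    unfolding filter image_image by (rule image_cong) (use del that in auto)
  then have gens: "subdivision_generators (g x) (g y) (g a) ((`) g ` \<Delta>)
      = (`) g ` subdivision_generators x y a \<Delta>"
    unfolding subdivision_generators_def image_Un using x y filter by simp
  show ?thesis
    unfolding subdivide_edge_eq gens by (auto simp: subset_image_iff)
qed

text \<open>The edge is pulled back, and a new vertex exists outside the finite vertex set because
  the type is infinite. Finiteness returns in the conclusion so that the step can be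
  iterated.\<close>

lemma edge_subdivision_lift_iso:
  fixes \<Delta> :: "'a set set"
  assumes inf: "infinite (UNIV :: 'a set)" and fin: "finite (\<Union>\<Delta>)"
    and iso: "simplicial_iso \<Delta> \<Delta>'" and sub: "edge_subdivision \<Delta>' \<Gamma>'"
  shows "\<exists>\<Gamma>. edge_subdivision \<Delta> \<Gamma> \<and> finite (\<Union>\<Gamma>) \<and> simplicial_iso \<Gamma> \<Gamma>'"
proof -
  obtain f where inj: "inj_on f (\<Union>\<Delta>)" and img: "(`) f ` \<Delta> = \<Delta>'"
    using iso unfolding simplicial_iso_iff by blast
  obtain x' y' a' where sc: "simplicial_complex \<Delta>'" and xy': "x' \<noteq> y'" "{x', y'} \<in> \<Delta>'"
      and a': "a' \<notin> \<Union>\<Delta>'" and \<Gamma>': "\<Gamma>' = subdivide_edge x' y' a' \<Delta>'"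
    using sub unfolding edge_subdivision_def by blast
  obtain e where e: "e \<in> \<Delta>" "f ` e = {x', y'}" using xy'(2) img by auto
  \<comment> \<open>Preimages taken inside the face \<open>e\<close> make \<open>{x, y}\<close> a
    face by closure under subsets.\<close>
  obtain x y where xy: "x \<in> e" "y \<in> e" "f x = x'" "f y = y'"
    using e(2) by (metis imageE insertI1 insertI2)
  have sc\<Delta>: "simplicial_complex \<Delta>" using simplicial_complex_if_iso[OF iso sc] .
  have edge: "{x, y} \<in> \<Delta>"
    using sc\<Delta> e xy unfolding simplicial_complex_def by auto
  have xU: "x \<in> \<Union>\<Delta>" "y \<in> \<Union>\<Delta>" using e xy by auto
  obtain a where a: "a \<notin> \<Union>\<Delta>" using ex_new_if_finite[OF inf fin] by blast
  \<comment> \<open>\<open>g\<close> extends the isomorphism by matching the two new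
    vertices.\<close>
  define g where "g = f(a := a')"
  have eq: "g ` \<sigma> = f ` \<sigma>" if "\<sigma> \<in> \<Delta>" for \<sigma>
    using that a by (auto simp: g_def)
  have img': "(`) g ` \<Delta> = \<Delta>'"
    using eq img by (metis image_cong)
  have gf: "g z = f z" if "z \<in> \<Union>\<Delta>" for z
    using that a by (auto simp: g_def)
  have "f ` \<Union>\<Delta> = \<Union>\<Delta>'" using img by blast
  then have "g a \<notin> g ` \<Union>\<Delta>" using a' gf by (simp add: g_def)
  moreover have "inj_on g (\<Union>\<Delta>)" by (rule iffD2[OF inj_on_cong[OF gf] inj])
  ultimately have inj': "inj_on g (insert a (\<Union>\<Delta>))" using a by simp
  have "(`) g ` subdivide_edge x y a \<Delta> = \<Gamma>'"
    using image_subdivide_edge[OF inj' xU] gf xU xy img' \<Gamma>' by (simp add: g_def)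
  then have "simplicial_iso (subdivide_edge x y a \<Delta>) \<Gamma>'"
    unfolding simplicial_iso_iff
    using inj_on_subset[OF inj' Union_subdivide_edge_subset] by blast
  moreover have "edge_subdivision \<Delta> (subdivide_edge x y a \<Delta>)"
    unfolding edge_subdivision_def
    by (intro conjI exI[of _ x] exI[of _ y] exI[of _ a] sc\<Delta> edge a refl) (use xy xy' in auto)
  moreover have "finite (\<Union>(subdivide_edge x y a \<Delta>))"
    by (rule finite_subset[OF Union_subdivide_edge_subset]) (simp only: finite_insert fin)
  ultimately show ?thesis by blast
qed

lemma edge_subdivisions_lift_iso:
  fixes \<Delta> :: "'a set set"
  assumes inf: "infinite (UNIV :: 'a set)" and fin: "finite (\<Union>\<Delta>)"
    and iso: "simplicial_iso \<Delta> \<Delta>'" and sub: "(edge_subdivision ^^ n) \<Delta>' \<Gamma>'"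
  shows "\<exists>\<Gamma>. (edge_subdivision ^^ n) \<Delta> \<Gamma> \<and> finite (\<Union>\<Gamma>) \<and> simplicial_iso \<Gamma> \<Gamma>'"
  using sub
proof (induction n arbitrary: \<Gamma>')
  case 0
  then show ?case using fin iso by auto
next
  case (Suc n)
  then obtain \<Theta>' where "(edge_subdivision ^^ n) \<Delta>' \<Theta>'" and last: "edge_subdivision \<Theta>' \<Gamma>'"
    by auto
  with Suc.IH obtain \<Theta> where \<Theta>: "(edge_subdivision ^^ n) \<Delta> \<Theta>" "finite (\<Union>\<Theta>)"
      "simplicial_iso \<Theta> \<Theta>'"
    by blast
  then show ?case
    using edge_subdivision_lift_iso[OF inf \<Theta>(2,3) last] by auto
qed

section \<open>Subdivisions of independence complexes\<close>

lemma simplicial_complex_ind_complex: "simplicial_complex (ind_complex G)"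
  unfolding simplicial_complex_def ind_complex_def by (auto intro: finite_subset)

text \<open>As edges lie in \<open>V\<close>, an injective relabelling neither creates nor destroys
  inclusions of edges in subsets of \<open>V\<close>.\<close>

lemma image_ind_complex:
  assumes inj: "inj_on f V" and E: "E \<subseteq> Pow V"
  shows "(`) f ` ind_complex (V, E) = ind_complex (f ` V, (`) f ` E)"
proof (intro subset_antisym subsetI)
  have iff: "f ` e \<subseteq> f ` \<sigma> \<longleftrightarrow> e \<subseteq> \<sigma>" if "\<sigma> \<subseteq> V" "e \<in> E" for e \<sigma>
    using inj_on_image_subset_iff[OF inj] that E by blast
  {
    fix \<tau> assume "\<tau> \<in> (`) f ` ind_complex (V, E)"
    then show "\<tau> \<in> ind_complex (f ` V, (`) f ` E)"
      using iff by (auto simp: ind_complex_def)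
  next
    fix \<tau> assume \<tau>: "\<tau> \<in> ind_complex (f ` V, (`) f ` E)"
    then obtain \<sigma> where \<sigma>: "\<sigma> \<subseteq> V" "\<tau> = f ` \<sigma>"
      by (auto simp: ind_complex_def subset_image_iff)
    then have "finite \<sigma>"
      using \<tau> inj_on_subset[OF inj] finite_imageD by (auto simp: ind_complex_def)
    then have "\<sigma> \<in> ind_complex (V, E)"
      using \<tau> \<sigma> iff by (auto simp: ind_complex_def)
    then show "\<tau> \<in> (`) f ` ind_complex (V, E)" using \<sigma> by blast
  }
qed

text \<open>A generator through \<open>a\<close> comes from an independent set containing both
  \<open>x\<close> and \<open>y\<close>, so it avoids all neighbours of either. Conversely,
  replacing \<open>a\<close> by \<open>x\<close> and \<open>y\<close> in an independent set of the
  new graph leaves a set independent in the old one.\<close>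

lemma subdivide_edge_ind_complex:
  assumes E: "\<And>e. e \<in> E \<Longrightarrow> e \<subseteq> V \<and> card e = 2"
    and xy: "x \<in> V" "y \<in> V" "x \<noteq> y" "{x, y} \<notin> E" and a: "a \<notin> V"
  shows "subdivide_edge x y a (ind_complex (V, E)) =
    ind_complex (insert a V,
      E \<union> {{x, y}} \<union> {{a, v} | v. {v, x} \<in> E \<or> {v, y} \<in> E})" (is "?L = ind_complex (_, ?E')")
proof (intro subset_antisym subsetI)
  fix \<tau> assume "\<tau> \<in> ?L"
  then obtain \<rho> where \<rho>: "\<rho> \<in> subdivision_generators x y a (ind_complex (V, E))" "\<tau> \<subseteq> \<rho>"
    unfolding subdivide_edge_eq by blast
  have aE: "a \<notin> e" if "e \<in> E" for e using that E a by blast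
  have "\<rho> \<in> ind_complex (insert a V, ?E')"
  proof (cases "\<rho> \<in> ind_complex (V, E)")
    case True
    moreover have "a \<notin> \<rho>" using True a by (auto simp: ind_complex_def)
    moreover have "\<not> {x, y} \<subseteq> \<rho>"
      using \<rho>(1) \<open>a \<notin> \<rho>\<close> unfolding subdivision_generators_def by blast
    ultimately show ?thesis by (auto simp: ind_complex_def)
  next
    case False
    then obtain \<sigma> z where \<sigma>: "\<sigma> \<in> ind_complex (V, E)" "{x, y} \<subseteq> \<sigma>" "z \<in> {x, y}"
        "\<rho> = (\<sigma> - {z}) \<union> {a}"
      using \<rho>(1) unfolding subdivision_generators_def by blast
    have "\<not> e \<subseteq> \<rho>" if e: "e \<in> ?E'" for e
    proof
      assume e\<rho>: "e \<subseteq> \<rho>"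
      consider "e \<in> E" | "e = {x, y}" | v where "e = {a, v}" "{v, x} \<in> E \<or> {v, y} \<in> E"
        using e by blast
      then show False
      proof cases
        case 1
        then have "e \<subseteq> \<sigma>" using e\<rho> \<sigma>(4) aE by blast
        then show False using 1 \<sigma>(1) by (auto simp: ind_complex_def)
      next
        case 2
        then show False using e\<rho> \<sigma>(3,4) xy a by auto
      next
        case 3
        \<comment> \<open>Hence \<open>v\<close> lies in \<open>\<sigma>\<close>, which contains
          both \<open>x\<close> and \<open>y\<close> and so whichever edge of \<open>E\<close> joins
          \<open>v\<close> to one of them.\<close>
        then have "v \<noteq> a" using aE by blast
        then have "{v, x} \<subseteq> \<sigma> \<and> {v, y} \<subseteq> \<sigma>" using 3 e\<rho> \<sigma>(2,4) by auto
        then show False using 3 \<sigma>(1) by (auto simp: ind_complex_def)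
      qed
    qed
    then show ?thesis using \<sigma> by (auto simp: ind_complex_def)
  qed
  then show "\<tau> \<in> ind_complex (insert a V, ?E')"
    using \<rho>(2) simplicial_complex_ind_complex unfolding simplicial_complex_def by blast
next
  fix \<tau> assume \<tau>: "\<tau> \<in> ind_complex (insert a V, ?E')"
  then have indep: "\<forall>e\<in>?E'. \<not> e \<subseteq> \<tau>"
    unfolding ind_complex_def mem_Collect_eq fst_conv snd_conv by (elim conjE)
  then have nxy: "\<not> {x, y} \<subseteq> \<tau>" by simp
  show "\<tau> \<in> ?L"
  proof (cases "a \<in> \<tau>")
    case False
    then have "\<tau> \<in> ind_complex (V, E)" using \<tau> by (auto simp: ind_complex_def)
    then show ?thesis
      using nxy unfolding subdivide_edge_eq subdivision_generators_def by blast
  next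
    case True
    define \<sigma> where "\<sigma> = (\<tau> - {a}) \<union> {x, y}"
    have nb: "{v, x} \<notin> E \<and> {v, y} \<notin> E" if "v \<in> \<tau>" for v
    proof (rule ccontr)
      assume "\<not> ?thesis"
      then have "{a, v} \<in> ?E'" by blast
      then show False using bspec[OF indep, of "{a, v}"] that True by simp
    qed
    have "\<not> e \<subseteq> \<sigma>" if e: "e \<in> E" for e
    proof
      assume sub: "e \<subseteq> \<sigma>"
      \<comment> \<open>Not lying inside \<open>\<tau>\<close>, the edge has an end in
        \<open>{x, y}\<close>. Its other end is in \<open>\<tau>\<close>, which \<open>nb\<close>
        excludes, or is the other of \<open>x\<close> and \<open>y\<close>, which are
        nonadjacent.\<close>
      obtain p q where pq: "e = {p, q}" "p \<noteq> q" using E[OF e] by (auto simp: card_2_iff)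
      have "\<not> e \<subseteq> \<tau>" using indep e by blast
      moreover have "p \<in> \<tau> \<or> p = x \<or> p = y" "q \<in> \<tau> \<or> q = x \<or> q = y"
        using pq sub unfolding \<sigma>_def by auto
      moreover have "{q, p} \<in> E" "{p, q} \<in> E" using e pq by (simp_all add: insert_commute)
      ultimately show False
        using pq nb[of p] nb[of q] xy(4) by (elim disjE) (simp_all add: insert_commute)
    qed
    then have \<sigma>: "\<sigma> \<in> ind_complex (V, E)" "{x, y} \<subseteq> \<sigma>"
      using \<tau> xy by (auto simp: ind_complex_def \<sigma>_def)
    consider "x \<notin> \<tau>" | "y \<notin> \<tau>" using nxy by blast
    then have "\<exists>z\<in>{x, y}. \<tau> \<subseteq> (\<sigma> - {z}) \<union> {a}"
      by cases (auto simp: \<sigma>_def)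
    then show ?thesis
      using \<sigma> unfolding subdivide_edge_eq subdivision_generators_def by blast
  qed
qed

lemma edge_subdivision_ind_complex:
  assumes E: "\<And>e. e \<in> E \<Longrightarrow> e \<subseteq> V \<and> card e = 2"
    and xy: "x \<in> V" "y \<in> V" "x \<noteq> y" "{x, y} \<notin> E" and a: "a \<notin> V"
  shows "edge_subdivision (ind_complex (V, E))
    (ind_complex (insert a V,
      E \<union> {{x, y}} \<union> {{a, v} | v. {v, x} \<in> E \<or> {v, y} \<in> E}))"
proof -
  \<comment> \<open>An edge has two elements, so inside \<open>{x, y}\<close> it could only be
    \<open>{x, y}\<close> itself.\<close>
  have "\<not> e \<subseteq> {x, y}" if "e \<in> E" for e
    using card_subset_eq[of "{x, y}" e] E[OF that] xy that by auto
  then have "{x, y} \<in> ind_complex (V, E)"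
    using xy by (auto simp: ind_complex_def)
  moreover have "a \<notin> \<Union>(ind_complex (V, E))" using a by (auto simp: ind_complex_def)
  ultimately show ?thesis
    unfolding edge_subdivision_def
    using simplicial_complex_ind_complex xy(3) subdivide_edge_ind_complex[OF assms, symmetric]
    by blast
qed

section \<open>From the matching to \<open>G\<^sub>m\<close>\<close>

lemma G_graph_Suc:
  assumes "k \<ge> 1"
  shows "fst (G_graph (Suc k)) = fst (G_graph k) \<union> {Va (Suc k), Vb (Suc k), Vc (Suc k)}"
    and "snd (G_graph (Suc k)) = snd (G_graph k)
      \<union> {{Va k, Va (Suc k)}, {Vb k, Vc (Suc k)}, {Va (Suc k), Vb (Suc k)}, {Vb (Suc k), Vc (Suc k)}}
      \<union> (if k \<ge> 2 then {{Vc k, Va (Suc k)}} else {})"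
  using assms by (cases k; simp add: Let_def case_prod_beta)+

fun vertex_index :: "vertex \<Rightarrow> nat" where
  "vertex_index (Va i) = i"
| "vertex_index (Vb i) = i"
| "vertex_index (Vc i) = i"

lemma G_graph_vertices:
  assumes "k \<ge> 1"
  shows "Va k \<in> fst (G_graph k)" "Vb k \<in> fst (G_graph k)" "k \<ge> 2 \<Longrightarrow> Vc k \<in> fst (G_graph k)"
proof -
  obtain j where j: "k = Suc j" using assms by (cases k) auto
  have "Va k \<in> fst (G_graph k) \<and> Vb k \<in> fst (G_graph k) \<and> (k \<ge> 2 \<longrightarrow> Vc k \<in> fst (G_graph k))"
  proof (cases "j = 0")
    case False
    then show ?thesis using j G_graph_Suc(1)[of j] by simp
  qed (simp add: j)
  then show "Va k \<in> fst (G_graph k)" "Vb k \<in> fst (G_graph k)"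
    "k \<ge> 2 \<Longrightarrow> Vc k \<in> fst (G_graph k)" by auto
qed

lemma vertex_index_le:
  assumes "k \<ge> 1" "v \<in> fst (G_graph k)"
  shows "vertex_index v \<le> k"
  using assms
proof (induction k rule: nat_induct_at_least)
  case (Suc k)
  then show ?case by (fastforce simp: G_graph_Suc(1) simp del: G_graph.simps)
qed auto

lemma G_graph_edges:
  assumes "k \<ge> 1" "e \<in> snd (G_graph k)"
  shows "e \<subseteq> fst (G_graph k) \<and> card e = 2"
  using assms
proof (induction k arbitrary: e rule: nat_induct_at_least)
  case base
  then show ?case by simp
next
  case (Suc k)
  then show ?case
    using G_graph_vertices[of k]
    by (auto simp: G_graph_Suc simp del: G_graph.simps split: if_splits)
qed

text \<open>Edges inherited from the previous level avoid \<open>Vb k\<close> because of its index,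
  and \<open>{Vb k, Vc (Suc k)}\<close> only appears at the next level.\<close>

lemma G_graph_neighbours_Vb:
  assumes "k \<ge> 1"
  shows "{v, Vb k} \<in> snd (G_graph k) \<longleftrightarrow> v = Va k \<or> (k \<ge> 2 \<and> v = Vc k)"
proof (cases "k = 1")
  case True
  then show ?thesis by (auto simp: doubleton_eq_iff)
next
  case False
  then obtain j where j: "k = Suc j" "j \<ge> 1" using assms by (cases k) auto
  have "{v, Vb k} \<notin> snd (G_graph j)"
    using G_graph_edges[OF j(2), of "{v, Vb k}"] vertex_index_le[OF j(2), of "Vb k"] j by auto
  then show ?thesis
    using j by (auto simp: G_graph_Suc doubleton_eq_iff simp del: G_graph.simps)
qed

text \<open>Interpolates, for \<open>m \<ge> 1\<close>, between a perfect matching on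
  \<open>2 * m\<close> vertices at \<open>k = 1\<close> and \<open>G_graph m\<close> at
  \<open>k = m\<close>; the matching edges are those still to be absorbed.\<close>

definition G_matching_graph :: "nat \<Rightarrow> nat \<Rightarrow> vertex graph" where
  "G_matching_graph m k =
     (fst (G_graph k) \<union> Vb ` {k<..m} \<union> Vc ` {k<..m},
      snd (G_graph k) \<union> (\<lambda>i. {Vb i, Vc i}) ` {k<..m})"

lemma G_matching_graph_full: "G_matching_graph m m = G_graph m"
  by (simp add: G_matching_graph_def)

text \<open>Of the edges new in \<open>G_graph (Suc k)\<close>,
  \<open>{Vb (Suc k), Vc (Suc k)}\<close> is already a matching edge,
  \<open>{Vb k, Vc (Suc k)}\<close> is the subdivided pair, and the rest join the new vertex
  \<open>Va (Suc k)\<close> to the neighbours of that pair.\<close>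

lemma edge_subdivision_G_matching_graph:
  assumes k: "1 \<le> k" "k < m"
  shows "edge_subdivision (ind_complex (G_matching_graph m k))
    (ind_complex (G_matching_graph m (Suc k)))"
proof -
  define V where "V = fst (G_matching_graph m k)"
  define E where "E = snd (G_matching_graph m k)"
  have split: "{k<..m} = insert (Suc k) {Suc k<..m}" using k by auto
  have E: "e \<subseteq> V \<and> card e = 2" if "e \<in> E" for e
    using that G_graph_edges[OF k(1)] unfolding E_def V_def G_matching_graph_def by auto
  have notG: "v \<notin> fst (G_graph k)" if "vertex_index v > k" for v
    using vertex_index_le[OF k(1), of v] that by auto
  then have notE: "{v, w} \<notin> snd (G_graph k)" if "vertex_index w > k" for v w
    using that G_graph_edges[OF k(1), of "{v, w}"] by auto
  have x: "{v, Vb k} \<in> E \<longleftrightarrow> v = Va k \<or> (k \<ge> 2 \<and> v = Vc k)" for v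
  proof -
    have "{v, Vb k} \<noteq> {Vb i, Vc i}" if "i \<in> {k<..m}" for i
      using that by (auto simp: doubleton_eq_iff)
    then show ?thesis
      using G_graph_neighbours_Vb[OF k(1), of v] unfolding E_def G_matching_graph_def snd_conv
      by blast
  qed
  \<comment> \<open>\<open>Vc (Suc k)\<close> lies outside \<open>G_graph k\<close>, so its matching
    partner is its only neighbour.\<close>
  have y: "{v, Vc (Suc k)} \<in> E \<longleftrightarrow> v = Vb (Suc k)" for v
  proof -
    have "{v, Vc (Suc k)} = {Vb i, Vc i} \<longleftrightarrow> v = Vb (Suc k) \<and> i = Suc k" for i
      by (auto simp: doubleton_eq_iff)
    moreover have "Suc k \<in> {k<..m}" using k by simp
    ultimately show ?thesis
      using notE[of "Vc (Suc k)" v] unfolding E_def G_matching_graph_def snd_conv image_iff Un_iff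
      by auto
  qed
  have "edge_subdivision (ind_complex (V, E))
    (ind_complex (insert (Va (Suc k)) V, E \<union> {{Vb k, Vc (Suc k)}}
      \<union> {{Va (Suc k), v} | v. {v, Vb k} \<in> E \<or> {v, Vc (Suc k)} \<in> E}))"
  proof (rule edge_subdivision_ind_complex[OF E])
    show "Vb k \<in> V" "Vc (Suc k) \<in> V"
      using G_graph_vertices[OF k(1)] k by (auto simp: V_def G_matching_graph_def)
    show "{Vb k, Vc (Suc k)} \<notin> E" by (simp add: y)
    show "Va (Suc k) \<notin> V"
      using notG[of "Va (Suc k)"] by (auto simp: V_def G_matching_graph_def)
  qed auto
  moreover have "insert (Va (Suc k)) V = fst (G_matching_graph m (Suc k))"
    unfolding V_def G_matching_graph_def split by (auto simp: G_graph_Suc[OF k(1)])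
  moreover have "{{Va (Suc k), v} | v. {v, Vb k} \<in> E \<or> {v, Vc (Suc k)} \<in> E}
      = {{Va k, Va (Suc k)}, {Va (Suc k), Vb (Suc k)}} \<union> (if k \<ge> 2 then {{Vc k, Va (Suc k)}} else {})"
    unfolding x y by (auto simp: insert_commute)
  then have "E \<union> {{Vb k, Vc (Suc k)}} \<union> {{Va (Suc k), v} | v. {v, Vb k} \<in> E \<or> {v, Vc (Suc k)} \<in> E}
      = snd (G_matching_graph m (Suc k))"
    unfolding E_def G_matching_graph_def split
    by (auto simp: G_graph_Suc[OF k(1)] simp del: G_graph.simps)
  ultimately show ?thesis
    by (simp add: V_def E_def)
qed

lemma edge_subdivisions_G_matching_graph:
  assumes "Suc k \<le> m"
  shows "(edge_subdivision ^^ k) (ind_complex (G_matching_graph m 1))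
    (ind_complex (G_matching_graph m (Suc k)))"
  using assms
proof (induction k)
  case (Suc k)
  then show ?case
    using edge_subdivision_G_matching_graph[of "Suc k" m] by auto
qed simp

section \<open>The boundary of the crosspolytope\<close>

text \<open>The common model: \<open>i\<close> selects a segment or a matching edge, and the Boolean
  selects one of its two ends.\<close>

definition perfect_matching :: "('n \<times> bool) graph" where
  "perfect_matching = (UNIV, range (\<lambda>i. {(i, True), (i, False)}))"

lemma ind_complex_perfect_matching:
  "T \<in> ind_complex (perfect_matching :: ('n::finite \<times> bool) graph) \<longleftrightarrow>
    (\<forall>i. (i, True) \<in> T \<longrightarrow> (i, False) \<notin> T)"
  by (auto simp: ind_complex_def perfect_matching_def)

lemma G_matching_graph_1_iso:
  assumes "CARD('n::finite) = m" "m \<ge> 1"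
  shows "\<exists>f :: 'n \<times> bool \<Rightarrow> vertex. inj f \<and>
    ind_complex (G_matching_graph m 1) = (`) f ` ind_complex perfect_matching"
proof -
  obtain h :: "'n \<Rightarrow> nat" where h: "bij_betw h UNIV {1..m}"
    using finite_same_card_bij[of "UNIV :: 'n set" "{1..m}"] assms(1) by auto
  \<comment> \<open>The first matching edge comes from \<open>G_graph 1\<close> and joins
    \<open>Va 1\<close> to \<open>Vb 1\<close>; there is no \<open>Vc 1\<close>, hence the exception
    at \<open>j = 1\<close>.\<close>
  define s t where "s j = (if j = 1 then Va 1 else Vb j)" and "t j = (if j = 1 then Vb 1 else Vc j)"
    for j
  define f where "f = (\<lambda>(i, b). if b then s (h i) else t (h i))"
  have hinj: "h i = h j \<longleftrightarrow> i = j" for i j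
    using h by (auto simp: bij_betw_def inj_on_def)
  have "inj f"
    by (rule injI) (auto simp: f_def s_def t_def hinj split: if_splits prod.splits,
      (metis hinj)+)
  have rng: "range h = {1..m}" using h by (simp add: bij_betw_def)
  have set: "{1..m} = insert 1 {1<..m}" using assms by auto
  have "range f = s ` range h \<union> t ` range h"
    by (auto simp: f_def image_iff split: if_splits) (metis (full_types))+
  also have "\<dots> = fst (G_matching_graph m 1)"
    unfolding rng set by (auto simp: G_matching_graph_def s_def t_def)
  finally have V: "range f = fst (G_matching_graph m 1)" .
  have "(`) f ` range (\<lambda>i. {(i, True), (i, False)}) = (\<lambda>j. {s j, t j}) ` range h"
    by (simp add: image_image f_def)
  also have "\<dots> = snd (G_matching_graph m 1)"
    unfolding rng set by (auto simp: G_matching_graph_def s_def t_def)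
  finally have E: "(`) f ` range (\<lambda>i. {(i, True), (i, False)}) = snd (G_matching_graph m 1)" .
  have "(`) f ` ind_complex perfect_matching = ind_complex (G_matching_graph m 1)"
    using image_ind_complex[of f UNIV "range (\<lambda>i. {(i, True), (i, False)})"] \<open>inj f\<close> V E
    by (simp add: perfect_matching_def)
  then show ?thesis using \<open>inj f\<close> by metis
qed

text \<open>Each independent \<open>T\<close> is cut out by a supporting hyperplane. Conversely, a
  face containing both ends of a segment contains the centre and is therefore all of
  \<open>P\<close>.\<close>

lemma boundary_complex_crosspolytope:
  fixes P :: "(real ^ 'n) set"
  assumes "crosspolytope P"
  shows "\<exists>v :: 'n \<times> bool \<Rightarrow> real ^ 'n. inj v \<and>
    boundary_complex P = (`) v ` ind_complex perfect_matching"
proof -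
  obtain c and u :: "'n \<Rightarrow> real ^ 'n" where nz: "\<And>i. u i \<noteq> 0"
      and orth: "\<And>i j. i \<noteq> j \<Longrightarrow> u i \<bullet> u j = 0"
      and P: "P = convex hull (\<Union>i. closed_segment (c - u i) (c + u i))"
    using assms unfolding crosspolytope_def orthogonal_def by blast
  define sg :: "bool \<Rightarrow> real" where "sg b = (if b then 1 else -1)" for b
  define v where "v = (\<lambda>(i, b). c + sg b *\<^sub>R u i)"
  have P_hull: "P = convex hull (range v)"
  proof (unfold P, rule subset_antisym; rule hull_minimal)
    have "c - u i \<in> range v" "c + u i \<in> range v" for i
      by (auto simp: v_def sg_def image_iff intro: exI[of _ "(i, False)"] exI[of _ "(i, True)"])
    then show "(\<Union>i. closed_segment (c - u i) (c + u i)) \<subseteq> convex hull (range v)"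
      by (intro UN_least closed_segment_subset) (auto intro: hull_inc)
    have "v (i, b) \<in> closed_segment (c - u i) (c + u i)" for i b
      by (cases b) (auto simp: v_def sg_def)
    then have "range v \<subseteq> (\<Union>i. closed_segment (c - u i) (c + u i))" by fast
    then show "range v \<subseteq> convex hull (\<Union>i. closed_segment (c - u i) (c + u i))"
      using hull_subset by (rule subset_trans)
  qed auto
  have v_in_P: "v p \<in> P" for p
    by (simp add: P_hull hull_inc)
  \<comment> \<open>The normal of the hyperplane for \<open>T\<close>. The scaling and orthogonality
    give it, for independent \<open>T\<close>, the value 1 on \<open>v p - c\<close> if
    \<open>p\<close> is in \<open>T\<close>, -1 if the opposite of \<open>p\<close> is, and 0
    otherwise.\<close>
  define \<phi> where "\<phi> T = (\<Sum>(i, b)\<in>T. (sg b / (u i \<bullet> u i)) *\<^sub>R u i)" for T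
  have \<phi>_v: "\<phi> T \<bullet> (v (j, b) - c) = sg b * (\<Sum>b'\<in>{b'. (j, b') \<in> T}. sg b')" for T j b
  proof -
    have "\<phi> T \<bullet> (v (j, b) - c) = (\<Sum>(i, b')\<in>T. sg b' * sg b * ((u i \<bullet> u j) / (u i \<bullet> u i)))"
      by (simp add: \<phi>_def v_def inner_sum_left case_prod_beta sum_distrib_left mult_ac)
    also have "\<dots> = (\<Sum>(i, b')\<in>T. if i = j then sg b' * sg b else 0)"
      using orth nz by (intro sum.cong) auto
    also have "\<dots> = (\<Sum>(i, b')\<in>{p \<in> T. fst p = j}. sg b' * sg b)"
      by (simp add: sum.inter_filter case_prod_beta)
    also have "\<dots> = (\<Sum>b'\<in>{b'. (j, b') \<in> T}. sg b' * sg b)"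
      by (rule sum.reindex_bij_witness[of _ "\<lambda>b'. (j, b')" snd]) auto
    finally show ?thesis by (simp add: sum_distrib_left mult.commute)
  qed
  have level: "\<phi> T \<bullet> (v p - c) \<le> 1" "\<phi> T \<bullet> (v p - c) = 1 \<longleftrightarrow> p \<in> T"
    if T: "T \<in> ind_complex perfect_matching" for T p
  proof -
    obtain j b where p: "p = (j, b)" by (cases p)
    have "{b'. (j, b') \<in> T} = (if (j, True) \<in> T then {True} else {})
        \<union> (if (j, False) \<in> T then {False} else {})"
      by (rule set_eqI, rename_tac b', case_tac b') auto
    then have "\<phi> T \<bullet> (v p - c) \<le> 1 \<and> (\<phi> T \<bullet> (v p - c) = 1 \<longleftrightarrow> p \<in> T)"
      using T unfolding p \<phi>_v ind_complex_perfect_matching by (cases b) (auto simp: sg_def)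
    then show "\<phi> T \<bullet> (v p - c) \<le> 1" "\<phi> T \<bullet> (v p - c) = 1 \<longleftrightarrow> p \<in> T" by auto
  qed
  \<comment> \<open>The functional belonging to \<open>{q}\<close> attains the value 1 at no vertex
    other than that of \<open>q\<close>.\<close>
  have "inj v"
  proof (rule injI)
    fix p q assume eq: "v p = v q"
    have "{q} \<in> ind_complex perfect_matching" by (cases q) (auto simp: ind_complex_perfect_matching)
    then show "p = q" using level(2)[of "{q}" p] level(2)[of "{q}" q] eq by simp
  qed
  \<comment> \<open>The inequality need only be checked at the vertices, since \<open>P\<close> is
    their hull.\<close>
  have face: "P \<inter> {x. \<phi> T \<bullet> x = 1 + \<phi> T \<bullet> c} face_of P"
    if T: "T \<in> ind_complex perfect_matching" for T
  proof (rule face_of_Int_supporting_hyperplane_le)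
    show "convex P" by (simp add: P_hull)
    have "P \<subseteq> {x. \<phi> T \<bullet> x \<le> 1 + \<phi> T \<bullet> c}"
      unfolding P_hull
      by (rule hull_minimal) (use level(1)[OF T] in \<open>auto simp: convex_halfspace_le inner_diff_right algebra_simps\<close>)
    then show "\<phi> T \<bullet> x \<le> 1 + \<phi> T \<bullet> c" if "x \<in> P" for x using that by blast
  qed
  have face_v: "v p \<in> P \<inter> {x. \<phi> T \<bullet> x = 1 + \<phi> T \<bullet> c} \<longleftrightarrow> p \<in> T"
    if T: "T \<in> ind_complex perfect_matching" for T p
    using level(2)[OF T, of p] v_in_P by (auto simp: inner_diff_right algebra_simps)
  have compact: "compact (range v)" by (simp add: finite_imp_compact)
  \<comment> \<open>The face for \<open>{p}\<close> is the hull of some of the points in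
    \<open>range v\<close>, and \<open>v p\<close> is the only one it contains.\<close>
  have ext: "v p extreme_point_of P" for p
  proof -
    have T: "{p} \<in> ind_complex perfect_matching"
      by (cases p) (auto simp: ind_complex_perfect_matching)
    define F where "F = P \<inter> {x. \<phi> {p} \<bullet> x = 1 + \<phi> {p} \<bullet> c}"
    obtain S where S: "S \<subseteq> range v" "F = convex hull S"
      using face_of_convex_hull_subset[OF compact] face[OF T] unfolding P_hull F_def by metis
    have "S \<subseteq> {v p}"
    proof
      fix x assume x: "x \<in> S"
      then obtain q where q: "x = v q" using S by blast
      have "v q \<in> F" using x q S(2) by (simp add: hull_inc)
      then show "x \<in> {v p}" using face_v[OF T, of q] q F_def by auto
    qed
    moreover have "v p \<in> F" using face_v[OF T, of p] F_def by simp
    ultimately have "F = {v p}" using S(2) by (auto simp: subset_singleton_iff)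
    then show ?thesis using face[OF T] F_def face_of_singleton by metis
  qed
  \<comment> \<open>Extreme points of a face are the extreme points of \<open>P\<close> lying in it,
    and those of \<open>P\<close> are exactly the points of \<open>range v\<close>.\<close>
  have ext_face: "{x. x extreme_point_of F} = v ` {p. v p \<in> F}" if "F face_of P" for F
  proof -
    have "x \<in> range v" if "x extreme_point_of P" for x
      using that extreme_point_of_convex_hull[of x "range v"] P_hull by simp
    then show ?thesis
      using extreme_point_of_face[OF that] ext by blast
  qed
  have "boundary_complex P = (`) v ` ind_complex perfect_matching"
  proof (intro subset_antisym subsetI)
    fix \<sigma> assume "\<sigma> \<in> boundary_complex P"
    then obtain F where F: "F face_of P" "F \<noteq> P" and \<sigma>: "\<sigma> = v ` {p. v p \<in> F}"
      unfolding boundary_complex_def using ext_face by blast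
    have False if i: "v (i, True) \<in> F" "v (i, False) \<in> F" for i
    proof -
      \<comment> \<open>The centre is interior to every segment, so a face containing it contains all vertices.\<close>
      have mid: "c = midpoint (v (j, True)) (v (j, False))" for j
        by (simp add: v_def sg_def midpoint_def algebra_simps flip: scaleR_2)
      have ne: "v (j, True) \<noteq> v (j, False)" for j
        using \<open>inj v\<close> by (simp add: inj_eq)
      have "convex F" using F(1) face_of_imp_convex by blast
      then have "c \<in> F"
        using closed_segment_subset[OF i] midpoint_in_closed_segment mid[of i] by (metis subsetD)
      moreover have "c \<in> open_segment (v (j, True)) (v (j, False))" for j
        using mid[of j] ne[of j] midpoint_in_open_segment by metis
      ultimately have "v (j, True) \<in> F \<and> v (j, False) \<in> F" for j
        using face_ofD[OF F(1)] v_in_P by blast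
      then have "v p \<in> F" for p by (cases p; cases "snd p") auto
      then have "P \<subseteq> F"
        unfolding P_hull using \<open>convex F\<close> by (intro hull_minimal) auto
      then show False using F face_of_imp_subset by blast
    qed
    then have "{p. v p \<in> F} \<in> ind_complex perfect_matching"
      by (auto simp: ind_complex_perfect_matching)
    then show "\<sigma> \<in> (`) v ` ind_complex perfect_matching" using \<sigma> by blast
  next
    fix \<sigma> assume "\<sigma> \<in> (`) v ` ind_complex perfect_matching"
    then obtain T where T: "T \<in> ind_complex perfect_matching" and \<sigma>: "\<sigma> = v ` T" by blast
    \<comment> \<open>For empty \<open>T\<close> the normal is 0 and the equation reads
      \<open>0 = 1\<close>, which yields the empty face.\<close>
    define F where "F = P \<inter> {x. \<phi> T \<bullet> x = 1 + \<phi> T \<bullet> c}"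
    have F: "F face_of P" using face[OF T] F_def by simp
    have vF: "{p. v p \<in> F} = T" using face_v[OF T] F_def by simp
    \<comment> \<open>An independent set misses an end of every segment, so the face is
      proper.\<close>
    obtain p where "p \<notin> T"
      using T unfolding ind_complex_perfect_matching by blast
    then have "F \<noteq> P" using vF v_in_P by blast
    moreover have "\<sigma> = {x. x extreme_point_of F}" using ext_face[OF F] vF \<sigma> by simp
    ultimately show "\<sigma> \<in> boundary_complex P"
      unfolding boundary_complex_def using F by blast
  qed
  then show ?thesis using \<open>inj v\<close> by blast
qed

theorem theorem3p14:
  fixes m :: nat and P :: "(real ^ 'n) set"
  assumes "m \<ge> 1" and "CARD('n) = m" and "crosspolytope P"
  shows "\<exists>K. (edge_subdivision ^^ (m - 1)) (boundary_complex P) K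
           \<and> simplicial_iso K (ind_complex (G_graph m))"
proof -
  obtain f :: "'n \<times> bool \<Rightarrow> vertex" where f: "inj f"
      "ind_complex (G_matching_graph m 1) = (`) f ` ind_complex perfect_matching"
    using G_matching_graph_1_iso[OF assms(2,1)] by (elim exE conjE)
  obtain v :: "'n \<times> bool \<Rightarrow> real ^ 'n" where v: "inj v"
      "boundary_complex P = (`) v ` ind_complex perfect_matching"
    using boundary_complex_crosspolytope[OF assms(3)] by (elim exE conjE)
  have iso: "simplicial_iso (boundary_complex P) (ind_complex (G_matching_graph m 1))"
    unfolding f(2) v(2) by (rule simplicial_iso_images[OF v(1) f(1)])
  have "\<Union>(boundary_complex P) \<subseteq> range v" unfolding v(2) by blast
  then have fin: "finite (\<Union>(boundary_complex P))" by (rule finite_subset) simp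
  \<comment> \<open>The ambient space supplies the new vertices of the lifted subdivisions.\<close>
  have inf: "infinite (UNIV :: (real ^ 'n) set)"
    using not_bounded_UNIV finite_imp_bounded by blast
  \<comment> \<open>The sequence starts at level 1, so \<open>m - 1\<close> steps reach level
    \<open>Suc (m - 1) = m\<close>, where no matching edge is left over.\<close>
  have "(edge_subdivision ^^ (m - 1)) (ind_complex (G_matching_graph m 1)) (ind_complex (G_graph m))"
    using edge_subdivisions_G_matching_graph[of "m - 1" m] assms(1) by (simp add: G_matching_graph_full)
  then show ?thesis
    using edge_subdivisions_lift_iso[OF inf fin iso] by blast
qed

end
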